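(* Let $\Lambda$ be a compact metric space, $(\Omega,\mathbb R,\sigma)$ a dynamical system on a compact metric space $\Omega$, $E$ a Banach space, and for each $\lambda\in\Lambda$ let $\varphi_\lambda$ be a cocycle on $(\Omega,\mathbb R,\sigma)$ with fibre $E$. Let $\lambda_0\in\Lambda$ and suppose: 1. the cocycle $\varphi_{\lambda_0}$ admits a compact global forward attractor $\{I^{\lambda_0}_\omega:\omega\in\Omega\}$; 2. for every $L>0$, $$m_L(\lambda):=\sup\{|\varphi_\lambda(t,x,\omega)-\varphi_{\lambda_0}(t,x,\omega)|:\ 0\le t\le L,\ \omega\in\Omega,\ |x|\le R_0\}\to0\quad\text{as }\lambda\to\lambda_0,$$ where $R_0>0$ is such that the set $I$ of condition 4 is contained in $B(0,R_0)$; 3. every cocycle $\varphi_\lambda$ admits a compact global attractor $\{I^\lambda_\omega:\omega\in\Omega\}$; 4. the set $I:=\bigcup\{I^\lambda:\lambda\in\Lambda\}$ is bounded in $E$, where $I^\lambda:=\bigcup\{I^\lambda_\omega:\omega\in\Omega\}$. Then $$\lim_{\lambda\to\lambda_0}\sup_{\omega\in\Omega}\beta(I^\lambda_\omega,I^{\lambda_0}_\omega)=0,$$ and in particular $\lim_{\lambda\to\lambda_0}\beta(I^\lambda,I^{\lambda_0})=0$.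
   Context: $\sigma$ is a continuous flow, $\omega t:=\sigma(t,\omega)$. A cocycle on $(\Omega,\mathbb R,\sigma)$ with fibre $E$ is a continuous map $\varphi:\mathbb R_+\times E\times\Omega\to E$ with $\varphi(0,x,\omega)=x$ and $\varphi(t+\tau,x,\omega)=\varphi(t,\varphi(\tau,x,\omega),\omega\tau)$. $B(0,R)$, $B[0,R]$ are the open and closed balls in $E$ centred at $0$; $\beta(P,Q):=\sup_{p\in P}\inf_{q\in Q}\rho(p,q)$ is the Hausdorff semi-distance. A family $\{I_\omega:\omega\in\Omega\}$ of nonempty compact subsets of $E$ is a compact global attractor of $\varphi$ if: (1) $\bigcup\{I_\omega:\omega\in\Omega\}$ is precompact; (2) $\varphi(t,I_\omega,\omega)=I_{\sigma(t,\omega)}$ for all $t\in\mathbb R_+$, $\omega\in\Omega$; (3) with $I=\bigcup_\omega I_\omega$, $\lim_{t\to+\infty}\sup_{\omega\in\Omega}\beta(\varphi(t,M,\omega),I)=0$ for every bounded $M\subset E$. It is a compact global forward attractor if moreover $\lim_{t\to\infty}\sup_{\omega\in\Omega}\beta(\varphi(t,B[0,R],\omega),I_{\omega t})=0$ for every $R>0$. For $\lambda=\lambda_0$ the families in conditions 1 and 3 are the same. *)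

theory Defs
  imports "HOL-Analysis.Analysis"
begin

definition continuous_flow :: "(real \<Rightarrow> 'w::topological_space \<Rightarrow> 'w) \<Rightarrow> bool" where
  "continuous_flow \<sigma> \<longleftrightarrow>
     continuous_on UNIV (\<lambda>(t, \<omega>). \<sigma> t \<omega>) \<and>
     (\<forall>\<omega>. \<sigma> 0 \<omega> = \<omega>) \<and>
     (\<forall>t s \<omega>. \<sigma> (t + s) \<omega> = \<sigma> t (\<sigma> s \<omega>))"

text \<open>Only the values of a cocycle at nonnegative times matter: continuity is that of
  the restriction to \<open>{0..} \<times> UNIV \<times> UNIV\<close>.\<close>

definition cocycle ::
  "(real \<Rightarrow> 'w::topological_space \<Rightarrow> 'w) \<Rightarrow> (real \<Rightarrow> 'e::topological_space \<Rightarrow> 'w \<Rightarrow> 'e) \<Rightarrow> bool" where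
  "cocycle \<sigma> \<phi> \<longleftrightarrow>
     continuous_on ({0..} \<times> UNIV \<times> UNIV) (\<lambda>(t, x, \<omega>). \<phi> t x \<omega>) \<and>
     (\<forall>x \<omega>. \<phi> 0 x \<omega> = x) \<and>
     (\<forall>t\<ge>0. \<forall>\<tau>\<ge>0. \<forall>x \<omega>. \<phi> (t + \<tau>) x \<omega> = \<phi> t (\<phi> \<tau> x \<omega>) (\<sigma> \<tau> \<omega>))"

text \<open>Valued in \<^typ>\<open>ennreal\<close>, because the image of a bounded set under a cocycle may be
  unbounded, and a real-valued supremum would then be meaningless. The supremum over
  \<open>P = {}\<close> is \<open>0\<close>.\<close>

definition hausdorff_semidist :: "'a::metric_space set \<Rightarrow> 'a set \<Rightarrow> ennreal" where
  "hausdorff_semidist P Q = (SUP p\<in>P. INF q\<in>Q. ennreal (dist p q))"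

text \<open>Precompactness in a complete space is expressed as compactness of the closure.\<close>

definition compact_global_attractor ::
  "(real \<Rightarrow> 'w \<Rightarrow> 'w) \<Rightarrow> (real \<Rightarrow> 'e::banach \<Rightarrow> 'w \<Rightarrow> 'e) \<Rightarrow> ('w \<Rightarrow> 'e set) \<Rightarrow> bool" where
  "compact_global_attractor \<sigma> \<phi> I \<longleftrightarrow>
     (\<forall>\<omega>. I \<omega> \<noteq> {} \<and> compact (I \<omega>)) \<and>
     compact (closure (\<Union>\<omega>. I \<omega>)) \<and>
     (\<forall>t\<ge>0. \<forall>\<omega>. (\<lambda>x. \<phi> t x \<omega>) ` I \<omega> = I (\<sigma> t \<omega>)) \<and>
     (\<forall>M. bounded M \<longrightarrow>
        ((\<lambda>t. SUP \<omega>. hausdorff_semidist ((\<lambda>x. \<phi> t x \<omega>) ` M) (\<Union>\<omega>'. I \<omega>')) \<longlongrightarrow> 0) at_top)"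

definition compact_global_forward_attractor ::
  "(real \<Rightarrow> 'w \<Rightarrow> 'w) \<Rightarrow> (real \<Rightarrow> 'e::banach \<Rightarrow> 'w \<Rightarrow> 'e) \<Rightarrow> ('w \<Rightarrow> 'e set) \<Rightarrow> bool" where
  "compact_global_forward_attractor \<sigma> \<phi> I \<longleftrightarrow>
     compact_global_attractor \<sigma> \<phi> I \<and>
     (\<forall>R>0. ((\<lambda>t. SUP \<omega>. hausdorff_semidist ((\<lambda>x. \<phi> t x \<omega>) ` cball 0 R) (I (\<sigma> t \<omega>))) \<longlongrightarrow> 0) at_top)"

end

theory Submission
  imports Defs
begin

text \<open>Fix \<open>L > 0\<close>. By invariance a point \<open>x\<close> of \<open>I \<mu> \<omega>\<close> equals \<open>\<phi> \<mu> L y \<omega>'\<close> with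
  \<open>\<omega>' = \<sigma> (-L) \<omega>\<close> and \<open>y\<close> in the ball of radius \<open>R0\<close>. Its distance to \<open>\<phi> \<mu>0 L y \<omega>'\<close> is at
  most \<open>m\<^sub>L(\<mu>)\<close>, while \<open>\<phi> \<mu>0 L y \<omega>'\<close> is close to \<open>I \<mu>0 \<omega>\<close> by forward attraction, uniformly
  in \<open>\<omega>\<close>. So one chooses \<open>L\<close> first, and then lets \<open>\<mu>\<close> tend to \<open>\<mu>0\<close>.\<close>

text \<open>Truncated subtraction is adjoint to addition in \<open>ennreal\<close>, so moving
  \<open>dist x y\<close> to the left reduces the claim to the triangle inequality for each single
  \<open>q\<close>.\<close>

lemma INF_ennreal_dist_triangle:
  fixes x y :: "'a::metric_space"
  shows "(INF q\<in>Q. ennreal (dist x q)) \<le> ennreal (dist x y) + (INF q\<in>Q. ennreal (dist y q))"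
proof -
  have "ennreal (dist x q) \<le> ennreal (dist x y) + ennreal (dist y q)" for q
    by (simp add: dist_triangle flip: ennreal_plus)
  then have "(INF q\<in>Q. ennreal (dist x q)) - ennreal (dist x y) \<le> (INF q\<in>Q. ennreal (dist y q))"
    by (intro INF_greatest) (auto simp: ennreal_minus_le_iff intro: INF_lower2)
  then show ?thesis
    by (simp add: ennreal_minus_le_iff)
qed

lemma hausdorff_semidist_point_le:
  "p \<in> P \<Longrightarrow> (INF q\<in>Q. ennreal (dist p q)) \<le> hausdorff_semidist P Q"
  unfolding hausdorff_semidist_def by (rule SUP_upper)

text \<open>Enlarging the target set only lowers the infimum, so a point of \<open>P j\<close> need
  only be compared with \<open>Q j\<close>. This carries the fibrewise limit over to the
  unions.\<close>

lemma hausdorff_semidist_UN_le: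
  "hausdorff_semidist (\<Union>i\<in>J. P i) (\<Union>i\<in>J. Q i) \<le> (SUP i\<in>J. hausdorff_semidist (P i) (Q i))"
proof -
  have "(INF q\<in>(\<Union>i\<in>J. Q i). ennreal (dist p q)) \<le> (SUP i\<in>J. hausdorff_semidist (P i) (Q i))"
    if "j \<in> J" "p \<in> P j" for j p
  proof -
    have "(INF q\<in>(\<Union>i\<in>J. Q i). ennreal (dist p q)) \<le> (INF q\<in>Q j. ennreal (dist p q))"
      using that by (intro INF_superset_mono) auto
    also have "\<dots> \<le> hausdorff_semidist (P j) (Q j)"
      using that by (intro hausdorff_semidist_point_le)
    also have "\<dots> \<le> (SUP i\<in>J. hausdorff_semidist (P i) (Q i))"
      using that by (intro SUP_upper)
    finally show ?thesis .
  qed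
  then show ?thesis
    unfolding hausdorff_semidist_def [of "\<Union>i\<in>J. P i"] by (auto intro!: SUP_least)
qed

text \<open>Since \<open>a\<close> may be infinite, it is not halved itself: density gives some
  \<open>b\<close> strictly below it, which is therefore finite and can be halved as a real.\<close>

lemma ennreal_half_real_below:
  fixes a :: ennreal
  assumes "a > 0"
  obtains e :: real where "e > 0" "ennreal e + ennreal e < a"
proof -
  obtain b where b: "0 < b" "b < a"
    using dense [OF assms] by auto
  then obtain r where r: "b = ennreal r" "r \<ge> 0"
    by (cases b) auto
  show thesis
    using b r by (intro that [of "r / 2"]) (simp_all flip: ennreal_plus)
qed

theorem theorem6p3:
  fixes \<sigma> :: "real \<Rightarrow> 'w::metric_space \<Rightarrow> 'w"
    and \<phi> :: "'l::metric_space \<Rightarrow> real \<Rightarrow> 'e::banach \<Rightarrow> 'w \<Rightarrow> 'e"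
    and I :: "'l \<Rightarrow> 'w \<Rightarrow> 'e set"
    and \<mu>0 :: 'l
    and R0 :: real
  assumes compact_parameters: "compact (UNIV :: 'l set)"
    and compact_base: "compact (UNIV :: 'w set)"
    and flow: "continuous_flow \<sigma>"
    and cocycles: "\<And>\<mu>. cocycle \<sigma> (\<phi> \<mu>)"
    and forward: "compact_global_forward_attractor \<sigma> (\<phi> \<mu>0) (I \<mu>0)"
    and R0_pos: "R0 > 0"
    and R0_ball: "(\<Union>\<mu>. \<Union>\<omega>. I \<mu> \<omega>) \<subseteq> ball 0 R0"
    and close: "\<And>L. L > 0 \<Longrightarrow>
      ((\<lambda>\<mu>. SUP (t, x, \<omega>) \<in> {0..L} \<times> cball 0 R0 \<times> UNIV.
              ennreal (norm (\<phi> \<mu> t x \<omega> - \<phi> \<mu>0 t x \<omega>))) \<longlongrightarrow> 0) (at \<mu>0)"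
    and attractors: "\<And>\<mu>. compact_global_attractor \<sigma> (\<phi> \<mu>) (I \<mu>)"
    and bounded_attractors: "bounded (\<Union>\<mu>. \<Union>\<omega>. I \<mu> \<omega>)"
  shows "((\<lambda>\<mu>. SUP \<omega>. hausdorff_semidist (I \<mu> \<omega>) (I \<mu>0 \<omega>)) \<longlongrightarrow> 0) (at \<mu>0) \<and>
         ((\<lambda>\<mu>. hausdorff_semidist (\<Union>\<omega>. I \<mu> \<omega>) (\<Union>\<omega>. I \<mu>0 \<omega>)) \<longlongrightarrow> 0) (at \<mu>0)"
proof
  let ?f = "\<lambda>\<mu>. SUP \<omega>. hausdorff_semidist (I \<mu> \<omega>) (I \<mu>0 \<omega>)"
  let ?m = "\<lambda>L \<mu>. SUP (t, x, \<omega>) \<in> {0..L} \<times> cball 0 R0 \<times> UNIV.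
              ennreal (norm (\<phi> \<mu> t x \<omega> - \<phi> \<mu>0 t x \<omega>))"
  let ?D = "\<lambda>t. SUP \<omega>. hausdorff_semidist ((\<lambda>x. \<phi> \<mu>0 t x \<omega>) ` cball 0 R0) (I \<mu>0 (\<sigma> t \<omega>))"
  have bound: "?f \<mu> \<le> ?m L \<mu> + ?D L" if "L > 0" for L \<mu>
  proof (rule SUP_least)
    fix \<omega>
    \<comment> \<open>The flow is two-sided, so \<omega> can be pulled back by time
      \<open>L\<close>. That \<omega>' varies with \<open>L\<close> is harmless, because
      \<open>?m\<close> and \<open>?D\<close> take suprema over the whole base.\<close>
    define \<omega>' where "\<omega>' = \<sigma> (- L) \<omega>"
    have \<omega>: "\<sigma> L \<omega>' = \<omega>"
      using flow unfolding continuous_flow_def \<omega>'_def by (metis add.right_inverse)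
    have inv: "(\<lambda>x. \<phi> \<mu> L x \<omega>') ` I \<mu> \<omega>' = I \<mu> \<omega>"
      using attractors [of \<mu>] that \<omega> unfolding compact_global_attractor_def by (metis less_imp_le)
    have "(INF q\<in>I \<mu>0 \<omega>. ennreal (dist x q)) \<le> ?m L \<mu> + ?D L" if x: "x \<in> I \<mu> \<omega>" for x
    proof -
      obtain y where y: "y \<in> I \<mu> \<omega>'" "x = \<phi> \<mu> L y \<omega>'"
        using x inv by blast
      have yR: "y \<in> cball 0 R0"
        using y R0_ball by (fastforce intro: less_imp_le)
      have "(INF q\<in>I \<mu>0 \<omega>. ennreal (dist x q))
          \<le> ennreal (dist x (\<phi> \<mu>0 L y \<omega>')) + (INF q\<in>I \<mu>0 \<omega>. ennreal (dist (\<phi> \<mu>0 L y \<omega>') q))"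
        by (rule INF_ennreal_dist_triangle)
      \<comment> \<open>The supremum in \<open>?m L \<mu>\<close> is tested at the endpoint
        \<open>t = L\<close> of the time interval.\<close>
      also have "ennreal (dist x (\<phi> \<mu>0 L y \<omega>')) \<le> ?m L \<mu>"
        using yR \<open>L > 0\<close> y by (intro SUP_upper2 [of "(L, y, \<omega>')"]) (auto simp: dist_norm)
      also have "(INF q\<in>I \<mu>0 \<omega>. ennreal (dist (\<phi> \<mu>0 L y \<omega>') q))
          \<le> hausdorff_semidist ((\<lambda>x. \<phi> \<mu>0 L x \<omega>') ` cball 0 R0) (I \<mu>0 \<omega>)"
        using yR by (intro hausdorff_semidist_point_le) auto
      also have "\<dots> \<le> ?D L"
        using \<omega> by (intro SUP_upper2 [of \<omega>']) auto
      finally show ?thesis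
        by (simp add: add_mono)
    qed
    then show "hausdorff_semidist (I \<mu> \<omega>) (I \<mu>0 \<omega>) \<le> ?m L \<mu> + ?D L"
      unfolding hausdorff_semidist_def [of "I \<mu> \<omega>"] by (rule SUP_least)
  qed
  \<comment> \<open>Nothing in \<open>ennreal\<close> lies below 0, so only upper bounds
    \<open>a > 0\<close> need an argument.\<close>
  show lim: "(?f \<longlongrightarrow> 0) (at \<mu>0)"
  proof (rule order_tendstoI)
    fix a :: ennreal
    assume "0 < a"
    then obtain e :: real where e: "e > 0" "ennreal e + ennreal e < a"
      by (rule ennreal_half_real_below)
    have "(?D \<longlongrightarrow> 0) at_top"
      using forward R0_pos unfolding compact_global_forward_attractor_def by blast
    then have "eventually (\<lambda>t. ?D t < ennreal e) at_top"
      using e by (intro order_tendstoD) auto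
    \<comment> \<open>Positivity of \<open>L\<close> is required by both \<open>close\<close> and
      \<open>bound\<close>. From here on \<open>L\<close> is fixed, independently of \<mu>.\<close>
    then obtain L where L: "L > 0" "?D L < ennreal e"
      using eventually_happens [OF eventually_conj [OF _ eventually_gt_at_top [of 0]]]
      by (metis (no_types, lifting) trivial_limit_at_top_linorder)
    have "eventually (\<lambda>\<mu>. ?m L \<mu> < ennreal e) (at \<mu>0)"
      using close [OF L(1)] e by (intro order_tendstoD) auto
    then show "eventually (\<lambda>\<mu>. ?f \<mu> < a) (at \<mu>0)"
    proof eventually_elim
      case (elim \<mu>)
      have "?f \<mu> \<le> ?m L \<mu> + ?D L"
        by (rule bound [OF L(1)])
      also have "\<dots> \<le> ennreal e + ennreal e"
        using elim L(2) by (intro add_mono less_imp_le)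
      also have "\<dots> < a"
        by (fact e)
      finally show ?case .
    qed
  qed simp
  show "((\<lambda>\<mu>. hausdorff_semidist (\<Union>\<omega>. I \<mu> \<omega>) (\<Union>\<omega>. I \<mu>0 \<omega>)) \<longlongrightarrow> 0) (at \<mu>0)"
    \<comment> \<open>The semi-distance of the unions is squeezed between 0 and
      \<open>?f\<close>.\<close>
    by (rule tendsto_sandwich [OF _ _ tendsto_const lim])
      (auto intro!: always_eventually hausdorff_semidist_UN_le)
qed

end
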